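(* Let $A \in \mathbb{R}^{m \times n}$, and let $\mathcal{U} = \mathrm{span}\{U\} \subseteq \mathbb{R}^m$ and $\mathcal{V} = \mathrm{span}\{V\} \subseteq \mathbb{R}^n$ be the left and right search subspaces, where $U \in \mathbb{R}^{m \times s_1}$ and $V \in \mathbb{R}^{n \times s_2}$ have orthonormal columns, so $\dim(\mathcal{U}) = s_1$, $\dim(\mathcal{V}) = s_2$, and put $s = s_1 + s_2$. Then the Ritz singular values $\theta_1 \ge \theta_2 \ge \dots \ge \theta_{\min(s_1,s_2)} \ge 0$ of $A$ with respect to $\mathcal{U}$ and $\mathcal{V}$ satisfy $$\theta_i = \min_{\substack{\mathcal{S}_u \subseteq \mathcal{U},\ \mathcal{S}_v \subseteq \mathcal{V} \\ \dim(\mathcal{S}_u) + \dim(\mathcal{S}_v) = s - i + 1}} \ \ \max_{\substack{u \in \mathcal{S}_u,\ v \in \mathcal{S}_v \\ \|u\| = \|v\| = 1}} u^T A v, \qquad i = 1, \ldots, \min(s_1, s_2),$$ where $\mathcal{S}_u$ and $\mathcal{S}_v$ range over linear subspaces.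
   Context: Given $A \in \mathbb{R}^{m\times n}$ and matrices $U \in \mathbb{R}^{m \times s_1}$, $V \in \mathbb{R}^{n \times s_2}$ with orthonormal columns, the Ritz singular values of $A$ with respect to the left search subspace $\mathrm{span}\{U\}$ (the column span of $U$) and the right search subspace $\mathrm{span}\{V\}$ are the $\min(s_1,s_2)$ singular values, counted with multiplicity and listed in decreasing order, of the projected matrix $H = U^T A V \in \mathbb{R}^{s_1 \times s_2}$. The norm $\|\cdot\|$ is the Euclidean norm. *)

theory Defs
  imports "HOL-Analysis.Analysis" "HOL-Computational_Algebra.Computational_Algebra"
    "HOL-Library.Multiset"
begin

definition orthonormal_columns :: "real^'s^'m \<Rightarrow> bool" where
  "orthonormal_columns U \<longleftrightarrow>
     (\<forall>j k. column j U \<bullet> column k U = (if j = k then 1 else 0))"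

definition charpoly :: "real^'n^'n \<Rightarrow> real poly" where
  "charpoly B = det (mat [:0, 1:] - map_matrix (\<lambda>c. [:c:]) B)"

text \<open>
  The singular values of an \<open>s1 \<times> s2\<close> matrix \<open>H\<close> are the square roots of the \<open>min s1 s2\<close>
  largest eigenvalues of \<open>H\<^sup>T H\<close>, with multiplicity (as roots of the characteristic
  polynomial) and in decreasing order. If \<open>s2 > s1\<close>, the eigenvalues cut off by \<open>take\<close>
  are the \<open>s2 - s1\<close> zeros forced by the shape of \<open>H\<close>.
  The list is indexed from 0, so \<open>\<theta>\<^sub>i\<close> is entry \<open>i - 1\<close>.
\<close>

definition singular_values :: "real^'s2^'s1 \<Rightarrow> real list" where
  "singular_values H =
     take (min CARD('s1) CARD('s2))
       (rev (sorted_list_of_multiset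
         (image_mset sqrt (proots (charpoly (transpose H ** H))))))"

definition ritz_singular_values ::
    "real^'n^'m \<Rightarrow> real^'s1^'m \<Rightarrow> real^'s2^'n \<Rightarrow> real list" where
  "ritz_singular_values A U V = singular_values (transpose U ** A ** V)"

text \<open>Unlike \<open>Sup\<close> and \<open>Inf\<close>, these demand that the extremum exists and is attained.\<close>

definition is_maximum :: "real set \<Rightarrow> real \<Rightarrow> bool" where
  "is_maximum X x \<longleftrightarrow> x \<in> X \<and> (\<forall>y\<in>X. y \<le> x)"

definition is_minimum :: "real set \<Rightarrow> real \<Rightarrow> bool" where
  "is_minimum X x \<longleftrightarrow> x \<in> X \<and> (\<forall>y\<in>X. x \<le> y)"

definition subspace_pairs ::
    "(real^'m) set \<Rightarrow> (real^'n) set \<Rightarrow> nat \<Rightarrow> ((real^'m) set \<times> (real^'n) set) set" where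
  "subspace_pairs \<U> \<V> d =
     {(Su, Sv). subspace Su \<and> Su \<subseteq> \<U> \<and> subspace Sv \<and> Sv \<subseteq> \<V> \<and> dim Su + dim Sv = d}"

definition unit_values :: "real^'n^'m \<Rightarrow> (real^'m) set \<Rightarrow> (real^'n) set \<Rightarrow> real set" where
  "unit_values A Su Sv =
     {u \<bullet> (A *v v) | u v. u \<in> Su \<and> v \<in> Sv \<and> norm u = 1 \<and> norm v = 1}"

end

theory Submission
  imports Defs
begin

text \<open>
  Write \<open>H = U\<^sup>T A V\<close> and \<open>k = i - 1\<close>. Since \<open>U\<close> and \<open>V\<close> are isometries onto the search subspaces, with
  \<open>U x \<bullet> A V y = x \<bullet> H y\<close>, pairs of subspaces of the search subspaces correspond to pairs of
  subspaces of the coordinate spaces, with the same dimensions and the same values on unit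
  vectors (\<open>subspace_pairs_span_columns\<close>, \<open>unit_values_image\<close>). So it suffices to prove the
  min-max formula for the matrix \<open>H\<close> and the full coordinate spaces (\<open>singular_system_minmax\<close>).

  Let \<open>w 0, w 1, \<dots>\<close> be orthonormal right singular vectors of \<open>H\<close>, in the order of decreasing singular
  values \<open>\<sigma> 0 \<ge> \<sigma> 1 \<ge> \<dots>\<close>. The pair consisting of the whole left space and the orthogonal complement of
  \<open>w 0, \<dots>, w (k - 1)\<close> has total dimension \<open>s1 + s2 - k\<close>, and \<open>norm (H v) \<le> \<sigma> k\<close> for unit vectors
  \<open>v\<close> in that complement (\<open>right_singular_system_norm_le\<close>); so its maximum is at most \<open>\<sigma> k\<close>.

  Conversely, two subspaces of total dimension \<open>s1 + s2 - k\<close> have total codimension \<open>k\<close>. Asking that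
  \<open>x = \<Sum>j\<le>k. c j w j\<close> lie in the right one and that the combination of left singular vectors
  with the same coefficients \<open>c j\<close> lie in the left one imposes \<open>k\<close> linear conditions on \<open>k + 1\<close>
  coefficients. A nonzero solution, normalized, gives unit vectors \<open>u\<close>, \<open>v\<close> with
  \<open>u \<bullet> H v = \<Sum>j\<le>k. (c j)\<^sup>2 \<sigma> j \<ge> \<sigma> k\<close> (\<open>right_singular_system_lower_witness\<close>). If \<open>\<sigma> k = 0\<close>, the
  symmetry \<open>u \<mapsto> - u\<close> gives the bound at once.

  The singular values are defined through the roots of the characteristic polynomial of \<open>H\<^sup>T H\<close>. To
  match them with vectors (\<open>right_singular_system_exists\<close>), the spectral theorem for symmetric
  matrices is proved by maximizing Rayleigh quotients (\<open>symmetric_matrix_diagonalization\<close>), and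
  the characteristic polynomial is seen to be that of the diagonal form
  (\<open>charpoly_eq_of_intertwining\<close>).
\<close>

section \<open>Diagonalization of symmetric matrices\<close>

lemma unit_vector_in_subspace:
  fixes S :: "'a::euclidean_space set"
  assumes "subspace S" "dim S > 0"
  obtains x where "x \<in> S" "norm x = 1"
proof -
  obtain z where z: "z \<in> S" "z \<noteq> 0"
    using assms(2) by (metis dim_eq_0 less_irrefl subsetI singletonI)
  then show thesis
    using that[of "z /\<^sub>R norm z"] assms(1) by (simp add: subspace_scale)
qed

text \<open>
  The maximum of the Rayleigh quotient \<open>x \<bullet> f x\<close> on the unit sphere of \<open>S\<close> is attained, and a
  maximizer \<open>x\<close> is an eigenvector: if the residual \<open>r = f x - (x \<bullet> f x) *\<^sub>R x\<close> were nonzero, moving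
  from \<open>x\<close> a little in the direction \<open>r\<close>, which stays inside \<open>S\<close>, would increase the quotient.
\<close>

lemma selfadjoint_eigenvector_in_invariant_subspace:
  fixes f :: "'a::euclidean_space \<Rightarrow> 'a"
  assumes lin: "linear f" and sa: "\<And>x y. f x \<bullet> y = x \<bullet> f y"
    and S: "subspace S" and inv: "f ` S \<subseteq> S" and nz: "dim S > 0"
  obtains x where "x \<in> S" "norm x = 1" "f x = (x \<bullet> f x) *\<^sub>R x"
proof -
  let ?K = "S \<inter> sphere 0 1"
  obtain z where "z \<in> S" "norm z = 1"
    using unit_vector_in_subspace[OF S nz] .
  then have "z \<in> ?K" by simp
  moreover have "compact ?K"
    by (simp add: S closed_Int_compact closed_subspace)
  moreover have "continuous_on ?K (\<lambda>x. x \<bullet> f x)"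
    by (intro continuous_intros linear_continuous_on linear_conv_bounded_linear[THEN iffD1] lin)
  ultimately obtain x where x: "x \<in> ?K" and mx: "\<And>y. y \<in> ?K \<Longrightarrow> y \<bullet> f y \<le> x \<bullet> f x"
    using continuous_attains_sup[of ?K "\<lambda>x. x \<bullet> f x"] by blast
  define l where "l = x \<bullet> f x"
  define r where "r = f x - l *\<^sub>R x"
  have xS: "x \<in> S" and x1: "norm x = 1"
    using x by auto
  have xx: "x \<bullet> x = 1"
    using x1 by (simp add: dot_square_norm)
  have rS: "r \<in> S"
    unfolding r_def using xS inv S by (auto intro!: subspace_diff subspace_scale)
  have quad: "y \<bullet> f y \<le> l * (y \<bullet> y)" if y: "y \<in> S" for y
  proof (cases "y = 0")
    case False
    have "y /\<^sub>R norm y \<in> ?K"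
      using y False S by (simp add: subspace_scale)
    from mx[OF this] have "(y \<bullet> f y) / (norm y)\<^sup>2 \<le> l"
      by (simp add: l_def linear_cmul[OF lin] power2_eq_square field_simps)
    then show ?thesis
      using False by (simp add: dot_square_norm field_simps)
  qed (simp add: linear_0[OF lin])
  have rx: "x \<bullet> r = 0"
    by (simp add: r_def l_def inner_diff_right xx)
  have rfx: "r \<bullet> f x = r \<bullet> r"
  proof -
    have "f x = r + l *\<^sub>R x" by (simp add: r_def)
    then show ?thesis using rx by (simp add: inner_add_right inner_commute)
  qed
  define K where "K = l * (r \<bullet> r) - r \<bullet> f r"
  (* Rayleigh bound at x + t r, after cancelling l and one factor t. *)
  have small: "2 * (r \<bullet> r) \<le> t * K" if t: "t > 0" for t :: real
  proof -
    have "x + t *\<^sub>R r \<in> S"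
      using xS rS S by (simp add: subspace_add subspace_scale)
    from quad[OF this]
    have "l + 2 * t * (r \<bullet> r) + t * t * (r \<bullet> f r) \<le> l * (1 + t * t * (r \<bullet> r))"
      using rx rfx sa[of x r]
      by (simp add: linear_add[OF lin] linear_cmul[OF lin] inner_add_left inner_add_right
          l_def[symmetric] xx inner_commute[of r x] inner_commute[of "f x" r] algebra_simps)
    then have "t * (2 * (r \<bullet> r)) \<le> t * (t * K)"
      by (simp add: K_def algebra_simps)
    then show ?thesis using t by simp
  qed
  have "r \<bullet> r \<le> 0"
  proof (rule ccontr)
    assume "\<not> r \<bullet> r \<le> 0"
    then have rr: "r \<bullet> r > 0" by linarith
    have K: "K > 0" using small[of 1] rr by linarith
    (* This t makes the right-hand side r \<bullet> r, half of the left-hand side. *)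
    show False using small[of "(r \<bullet> r) / K"] rr K by simp
  qed
  then have "r = 0"
    by (metis inner_gt_zero_iff not_le)
  then have "f x = (x \<bullet> f x) *\<^sub>R x"
    by (simp add: r_def l_def)
  with xS x1 that show thesis by blast
qed

text \<open>
  Induction on \<open>dim S\<close>: split off one eigenvector \<open>x\<close>; by self-adjointness its orthogonal
  complement in \<open>S\<close> is again invariant. Working with invariant subspaces of a fixed space, rather
  than with matrices of decreasing size, keeps the induction within one type.
\<close>

lemma selfadjoint_orthonormal_eigenbasis:
  fixes f :: "'a::euclidean_space \<Rightarrow> 'a"
  assumes lin: "linear f" and sa: "\<And>x y. f x \<bullet> y = x \<bullet> f y"
    and "subspace S" and "f ` S \<subseteq> S"
  shows "\<exists>B. B \<subseteq> S \<and> finite B \<and> card B = dim S \<and> pairwise orthogonal B \<and>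
           (\<forall>b\<in>B. norm b = 1 \<and> (\<exists>c. f b = c *\<^sub>R b))"
  using assms(3,4)
proof (induction "dim S" arbitrary: S)
  case 0
  then show ?case by (intro exI[of _ "{}"]) simp
next
  case (Suc n)
  obtain x where x: "x \<in> S" "norm x = 1" "f x = (x \<bullet> f x) *\<^sub>R x"
    using selfadjoint_eigenvector_in_invariant_subspace[OF lin sa Suc.prems] Suc.hyps(2)
    by (metis zero_less_Suc)
  define T where "T = {y \<in> S. \<forall>z\<in>span {x}. orthogonal z y}"
  have T: "T = {y \<in> S. x \<bullet> y = 0}"
    by (auto simp: T_def orthogonal_def span_singleton)
  have "dim T + dim (span {x}) = dim S"
    unfolding T_def using x(1) Suc.prems(1)
    by (intro dim_subspace_orthogonal_to_vectors) (auto simp: span_minimal)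
  moreover have "dim (span {x}) = 1"
    using x(2) by (auto simp: dim_singleton)
  ultimately have "n = dim T"
    using Suc.hyps(2) by simp
  moreover have "subspace T"
    using Suc.prems(1) by (auto simp: T subspace_def inner_add_right)
  moreover have "f ` T \<subseteq> T"
  proof -
    have "x \<bullet> f y = 0" if "x \<bullet> y = 0" for y
      using sa[of x y] x(3) that by (metis inner_scaleR_left mult_zero_right)
    then show ?thesis using Suc.prems(2) by (auto simp: T)
  qed
  ultimately obtain B where B: "B \<subseteq> T" "finite B" "card B = n" "pairwise orthogonal B"
      "\<forall>b\<in>B. norm b = 1 \<and> (\<exists>c. f b = c *\<^sub>R b)"
    using Suc.hyps(1)[of T] by auto
  have "x \<notin> B"
    using B(1) x(2) by (auto simp: T)
  then have "card (insert x B) = dim S"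
    using B(2,3) Suc.hyps(2) by simp
  moreover have "pairwise orthogonal (insert x B)"
    using B(1,4) by (auto simp: T pairwise_insert orthogonal_def inner_commute)
  moreover have "insert x B \<subseteq> S"
    using B(1) x(1) by (auto simp: T)
  ultimately show ?case
    using B(2,5) x(2,3) by (intro exI[of _ "insert x B"]) auto
qed

lemma symmetric_matrix_diagonalization:
  fixes B :: "real^'n^'n"
  assumes "transpose B = B"
  obtains Q :: "real^'n^'n" and d :: "'n \<Rightarrow> real"
  where "orthogonal_matrix Q" "B ** Q = Q ** (\<chi> i j. if i = j then d i else 0)"
proof -
  have sa: "(B *v x) \<bullet> y = x \<bullet> (B *v y)" for x y
    by (metis assms dot_lmul_matrix inner_commute transpose_matrix_vector)
  obtain E where E: "finite E" "card E = dim (UNIV :: (real^'n) set)" "pairwise orthogonal E"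
      "\<forall>b\<in>E. norm b = 1 \<and> (\<exists>c. B *v b = c *\<^sub>R b)"
    using selfadjoint_orthonormal_eigenbasis[OF matrix_vector_mul_linear sa, of UNIV] by auto
  have "card E = card (UNIV :: 'n set)"
    using E(2) by simp
  then obtain p where p: "bij_betw p (UNIV :: 'n set) E"
    using E(1) finite_same_card_bij by (metis finite)
  define Q :: "real^'n^'n" where "Q = (\<chi> i j. p j $ i)"
  have col: "column j Q = p j" for j
    by (simp add: column_def Q_def vec_eq_iff)
  have pE: "p j \<in> E" for j
    using p by (auto simp: bij_betw_def)
  have "\<forall>j. \<exists>c. B *v p j = c *\<^sub>R p j"
    using E(4) pE by auto
  then obtain d where d: "\<And>j. B *v p j = d j *\<^sub>R p j"
    by (auto dest!: choice)
  have "orthogonal (p i) (p j)" if "i \<noteq> j" for i j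
    using E(3) pE that inj_eq[OF bij_betw_imp_inj_on[OF p]] by (auto simp: pairwise_def)
  then have "orthogonal_matrix Q"
    using E(4) pE by (simp add: orthogonal_matrix_orthonormal_columns col)
  moreover have "B ** Q = Q ** (\<chi> i j. if i = j then d i else 0)"
  proof -
    have "(B ** Q) $ i $ j = (B *v p j) $ i" for i j
      by (simp add: matrix_matrix_mult_def matrix_vector_mult_def Q_def)
    then show ?thesis
      by (simp add: vec_eq_iff d matrix_matrix_mult_def Q_def if_distrib cong: if_cong)
  qed
  ultimately show thesis using that by blast
qed

section \<open>Characteristic polynomials of similar matrices\<close>

lemma map_matrix_const_poly_mult:
  "map_matrix (\<lambda>c. [:c:]) (A ** B) = map_matrix (\<lambda>c. [:c:]) A ** map_matrix (\<lambda>c. [:c:]) B"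
  for A :: "'a::comm_semiring_1^'n^'m" and B :: "'a^'k^'n"
proof -
  have "[:sum h I:] = (\<Sum>k\<in>I. [:h k:])" for h :: "'n \<Rightarrow> 'a" and I
    by (simp add: poly_eq_iff coeff_sum coeff_pCons split: nat.split)
  then show ?thesis
    by (simp add: vec_eq_iff matrix_matrix_mult_def mult.commute)
qed

text \<open>
  Since \<open>X I\<close> commutes with every matrix, \<open>B Q = Q D\<close> gives \<open>(X I - B) Q = Q (X I - D)\<close> over the
  polynomial ring; there \<open>det Q\<close> is a unit, hence can be cancelled from the determinants.
\<close>

lemma charpoly_eq_of_intertwining:
  fixes B D Q :: "real^'n^'n"
  assumes BQ: "B ** Q = Q ** D" and "invertible Q"
  shows "charpoly B = charpoly D"
proof -
  let ?C = "map_matrix (\<lambda>c. [:c:]) :: real^'n^'n \<Rightarrow> real poly^'n^'n"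
  let ?X = "mat [:0, 1:] :: real poly^'n^'n"
  have comm: "?X ** M = M ** ?X" for M
    by (simp add: vec_eq_iff matrix_matrix_mult_def mat_def if_distrib
        if_distribR mult.commute cong: if_cong)
  obtain R where "Q ** R = mat 1"
    using assms(2) by (auto simp: invertible_def)
  then have "?C Q ** ?C R = ?C (mat 1)"
    by (metis map_matrix_const_poly_mult)
  also have "\<dots> = mat 1"
    by (simp add: vec_eq_iff mat_def)
  finally have "det (?C Q) * det (?C R) = 1"
    by (metis det_I det_mul)
  then have nz: "det (?C Q) \<noteq> 0"
    by auto
  have distrib: "(?X - N) ** M = ?X ** M - N ** M" "M ** (?X - N) = M ** ?X - M ** N" for M N
    by (simp_all add: vec_eq_iff matrix_matrix_mult_def algebra_simps sum_subtractf)
  have "(?X - ?C B) ** ?C Q = ?C Q ** (?X - ?C D)"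
    using BQ by (simp add: distrib comm flip: map_matrix_const_poly_mult)
  then have "charpoly B * det (?C Q) = det (?C Q) * charpoly D"
    unfolding charpoly_def by (metis det_mul)
  then show ?thesis using nz by simp
qed

lemma proots_charpoly_diagonal:
  "proots (charpoly (\<chi> i j. if i = j then d i else 0)) = image_mset d (mset_set UNIV)"
  for d :: "'n::finite \<Rightarrow> real"
proof -
  have "charpoly (\<chi> i j. if i = j then d i else 0) = (\<Prod>i\<in>UNIV. [:- d i, 1:])"
    unfolding charpoly_def by (subst det_diagonal) (auto simp: mat_def)
  moreover have "proots (\<Prod>i\<in>I. [:- d i, 1:]) = image_mset d (mset_set I)" if "finite I" for I
    using that by induction (auto simp: proots_mult simp del: mult_pCons_left)
  ultimately show ?thesis by simp
qed

section \<open>Orthonormal families and dimension counting\<close>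

text \<open>
  The single computation behind all norm and inner product expansions below. The two families
  may differ because the lower bound pairs left singular vectors with images of right ones.
\<close>

lemma inner_sums_biorthogonal:
  fixes g h :: "nat \<Rightarrow> 'a::real_inner"
  assumes gh: "\<And>i j. i < m \<Longrightarrow> j < m \<Longrightarrow> g i \<bullet> h j = (if i = j then c i else 0)"
  shows "(\<Sum>i<m. a i *\<^sub>R g i) \<bullet> (\<Sum>j<m. b j *\<^sub>R h j) = (\<Sum>i<m. a i * b i * c i)"
proof -
  have "(\<Sum>i<m. a i *\<^sub>R g i) \<bullet> (\<Sum>j<m. b j *\<^sub>R h j)
      = (\<Sum>i<m. \<Sum>j<m. if i = j then a i * b i * c i else 0)"
    unfolding inner_sum_left inner_sum_right
    by (intro sum.cong) (auto simp: gh mult.assoc)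
  then show ?thesis by simp
qed

lemma orthonormal_family_span:
  fixes w :: "nat \<Rightarrow> 'a::euclidean_space"
  assumes w: "\<And>i j. i < m \<Longrightarrow> j < m \<Longrightarrow> w i \<bullet> w j = (if i = j then 1 else 0)"
  shows "dim (span (w ` {..<m})) = m"
    and "x \<in> span (w ` {..<m}) \<Longrightarrow> (\<Sum>j<m. (x \<bullet> w j) *\<^sub>R w j) = x"
proof -
  have inj: "inj_on w {..<m}"
    by (rule inj_onI) (metis lessThan_iff w zero_neq_one)
  have orth: "pairwise orthogonal (w ` {..<m})"
    by (auto simp: pairwise_def orthogonal_def w)
  have norm1: "norm b = 1" if "b \<in> w ` {..<m}" for b
    using that by (auto simp: norm_eq_1 w)
  have "independent (w ` {..<m})"
    using orth norm1 by (intro pairwise_orthogonal_independent) force+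
  then show "dim (span (w ` {..<m})) = m"
    by (simp add: dim_eq_card_independent card_image inj)
  show "(\<Sum>j<m. (x \<bullet> w j) *\<^sub>R w j) = x" if "x \<in> span (w ` {..<m})"
    using orthonormal_basis_expand[OF orth norm1 that] by (simp add: sum.reindex inj)
qed

lemma nonzero_vector_in_Int_of_dim:
  fixes S T :: "'a::euclidean_space set"
  assumes "subspace S" "subspace T" and "dim S + dim T > DIM('a)"
  obtains x where "x \<in> S" "x \<in> T" "x \<noteq> 0"
proof -
  have "dim {x + y |x y. x \<in> S \<and> y \<in> T} + dim (S \<inter> T) = dim S + dim T"
    using assms(1,2) by (rule dim_sums_Int)
  moreover have "dim {x + y |x y. x \<in> S \<and> y \<in> T} \<le> DIM('a)"
    by (rule dim_subset_UNIV)
  ultimately have "dim (S \<inter> T) \<noteq> 0"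
    using assms(3) by linarith
  then have "\<not> S \<inter> T \<subseteq> {0}"
    by (metis dim_eq_0)
  then show thesis
    using that by blast
qed

section \<open>Right singular vectors\<close>

text \<open>
  The vectors \<open>w 0, w 1, \<dots>\<close> are right singular vectors of \<open>H\<close>. Instead of the eigenvector equation
  for \<open>H\<^sup>T H\<close>, the orthogonality of the images \<open>H w i\<close> is recorded: it yields the norms
  of images in the min-max argument directly, and it makes \<open>H w i / \<sigma> i\<close> an orthonormal family of left singular vectors as far
  as \<open>\<sigma> i > 0\<close>. All \<open>CARD('s2)\<close> indices are included, also those beyond \<open>CARD('s1)\<close>, so
  that the \<open>w i\<close> form a basis.
\<close>

definition right_singular_system :: "real^'s2^'s1 \<Rightarrow> (nat \<Rightarrow> real^'s2) \<Rightarrow> (nat \<Rightarrow> real) \<Rightarrow> bool" where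
  "right_singular_system H w \<sigma> \<longleftrightarrow>
     (\<forall>i<CARD('s2). \<forall>j<CARD('s2). w i \<bullet> w j = (if i = j then 1 else 0)) \<and>
     (\<forall>i<CARD('s2). \<forall>j<CARD('s2). (H *v w i) \<bullet> (H *v w j) = (if i = j then (\<sigma> i)\<^sup>2 else 0)) \<and>
     (\<forall>i j. i \<le> j \<and> j < CARD('s2) \<longrightarrow> \<sigma> j \<le> \<sigma> i) \<and>
     (\<forall>i<CARD('s2). 0 \<le> \<sigma> i)"

text \<open>
  This links the singular values, defined through roots of a characteristic polynomial, to
  vectors. Diagonalizing \<open>H\<^sup>T H\<close> gives an eigenbasis indexed by the type \<open>'s2\<close>, and the roots of the
  characteristic polynomial are the corresponding eigenvalues with the same multiplicities;
  sorting the indices by eigenvalue then orders vectors and values simultaneously.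
\<close>

lemma right_singular_system_exists:
  fixes H :: "real^'s2^'s1"
  obtains w \<sigma> where "right_singular_system H w \<sigma>"
    "singular_values H = map \<sigma> [0..<min CARD('s1) CARD('s2)]"
proof -
  let ?G = "transpose H ** H"
  have "transpose ?G = ?G"
    by (simp add: matrix_transpose_mul)
  then obtain Q :: "real^'s2^'s2" and d where Q: "orthogonal_matrix Q"
    and GQ: "?G ** Q = Q ** (\<chi> i j. if i = j then d i else 0)"
    by (rule symmetric_matrix_diagonalization)
  have "invertible Q"
    using Q by (auto simp: invertible_def orthogonal_matrix_def)
  then have proots: "proots (charpoly ?G) = image_mset d (mset_set UNIV)"
    using charpoly_eq_of_intertwining[OF GQ] by (simp add: proots_charpoly_diagonal)
  have ortho: "column i Q \<bullet> column j Q = (if i = j then 1 else 0)" for i j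
    using Q by (auto simp: orthogonal_matrix_orthonormal_columns orthogonal_def norm_eq_1)
  (* The Gram matrix of the columns of H Q is the diagonal form of H\<^sup>T H. *)
  have "transpose (H ** Q) ** (H ** Q) = transpose Q ** (?G ** Q)"
    by (simp add: matrix_transpose_mul matrix_mul_assoc)
  also have "\<dots> = (\<chi> i j. if i = j then d i else 0)"
    using Q by (simp add: GQ matrix_mul_assoc orthogonal_matrix)
  finally have "column i (H ** Q) \<bullet> column j (H ** Q) = (if i = j then d i else 0)" for i j
    by (simp add: matrix_mult_transpose_dot_column vec_eq_iff)
  moreover have "column i (H ** Q) = H *v column i Q" for i
    by (metis matrix_vector_mul_assoc matrix_vector_mult_basis)
  ultimately have gram: "(H *v column i Q) \<bullet> (H *v column j Q) = (if i = j then d i else 0)" for i j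
    by metis
  have d0: "d i \<ge> 0" for i
    using gram[of i i] by (metis inner_ge_zero)

  (* Sorting an enumeration of the index type by the key sqrt (d i), rather than sorting the
     list of values, keeps track of the eigenvectors; the list is reversed to be decreasing. *)
  obtain xs :: "'s2 list" where xs: "set xs = UNIV" "distinct xs"
    using finite_distinct_list[of "UNIV :: 's2 set"] by auto
  define f where "f = (\<lambda>i. sqrt (d i))"
  define ys where "ys = rev (sort_key f xs)"
  have ys: "set ys = UNIV" "distinct ys"
    by (simp_all add: ys_def xs)
  have len: "length ys = CARD('s2)"
    using ys by (metis distinct_card)
  have "sorted_wrt (\<ge>) (map f ys)"
    by (simp add: ys_def rev_map[symmetric] sorted_wrt_rev)
  then have decr: "f (ys ! j) \<le> f (ys ! i)" if "i \<le> j" "j < CARD('s2)" for i j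
    using that len by (cases "i = j") (auto simp: sorted_wrt_iff_nth_less)
  have inj: "ys ! i = ys ! j \<longleftrightarrow> i = j" if "i < CARD('s2)" "j < CARD('s2)" for i j
    using that len ys(2) by (simp add: nth_eq_iff_index_eq)
  have "mset xs = mset_set UNIV"
    using xs by (metis mset_set_set)
  then have "image_mset sqrt (proots (charpoly ?G)) = mset (map f (sort_key f xs))"
    by (simp add: proots f_def multiset.map_comp comp_def)
  then have "sorted_list_of_multiset (image_mset sqrt (proots (charpoly ?G))) = map f (sort_key f xs)"
    by (simp only: sorted_list_of_multiset_mset) (simp add: sorted_sort_id)
  then have "rev (sorted_list_of_multiset (image_mset sqrt (proots (charpoly ?G)))) = map f ys"
    by (simp add: ys_def rev_map)
  also have "\<dots> = map (\<lambda>i. f (ys ! i)) [0..<CARD('s2)]"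
    by (metis len list.map_comp comp_def map_nth map_cong)
  finally have "singular_values H = map (\<lambda>i. f (ys ! i)) [0..<min CARD('s1) CARD('s2)]"
    by (simp add: singular_values_def take_map min_def)
  moreover have "right_singular_system H (\<lambda>i. column (ys ! i) Q) (\<lambda>i. f (ys ! i))"
    using decr d0 inj unfolding right_singular_system_def
    by (auto simp: ortho gram f_def)
  ultimately show thesis using that by blast
qed

text \<open>
  In the basis \<open>w\<close>, only components with index at least \<open>k\<close> survive in \<open>v\<close>, and \<open>H\<close> stretches each
  of them by a factor at most \<open>\<sigma> k\<close>, keeping them orthogonal.
\<close>

lemma right_singular_system_norm_le:
  fixes H :: "real^'s2^'s1"
  assumes sys: "right_singular_system H w \<sigma>" and k: "k < CARD('s2)"
    and orth: "\<And>j. j < k \<Longrightarrow> v \<bullet> w j = 0"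
  shows "norm (H *v v) \<le> \<sigma> k * norm v"
proof -
  let ?N = "CARD('s2)"
  have ww: "\<And>i j. i < ?N \<Longrightarrow> j < ?N \<Longrightarrow> w i \<bullet> w j = (if i = j then 1 else 0)"
    and HH: "\<And>i j. i < ?N \<Longrightarrow> j < ?N \<Longrightarrow> (H *v w i) \<bullet> (H *v w j) = (if i = j then (\<sigma> i)\<^sup>2 else 0)"
    and decr: "\<And>i j. i \<le> j \<Longrightarrow> j < ?N \<Longrightarrow> \<sigma> j \<le> \<sigma> i"
    and nonneg: "\<And>i. i < ?N \<Longrightarrow> 0 \<le> \<sigma> i"
    using sys unfolding right_singular_system_def by auto
  have "dim (span (w ` {..<?N})) = DIM(real^'s2)"
    using orthonormal_family_span(1)[OF ww] by simp
  then have "v \<in> span (w ` {..<?N})"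
    by (metis UNIV_I dim_eq_full dim_span span_span)
  then have exp: "v = (\<Sum>j<?N. (v \<bullet> w j) *\<^sub>R w j)"
    using orthonormal_family_span(2)[OF ww] by simp
  have sq: "v \<bullet> v = (\<Sum>j<?N. (v \<bullet> w j) * (v \<bullet> w j) * 1)"
    by (subst (1 2) exp) (simp add: inner_sums_biorthogonal[OF ww])
  have "H *v v = (\<Sum>j<?N. (v \<bullet> w j) *\<^sub>R (H *v w j))"
    by (subst exp) (simp add: linear_sum[OF matrix_vector_mul_linear] matrix_vector_mult_scaleR)
  then have "(norm (H *v v))\<^sup>2 = (\<Sum>j<?N. (v \<bullet> w j) * (v \<bullet> w j) * (\<sigma> j)\<^sup>2)"
    unfolding power2_norm_eq_inner
    by (simp add: inner_sums_biorthogonal[OF HH])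
  also have "\<dots> \<le> (\<Sum>j<?N. (\<sigma> k)\<^sup>2 * ((v \<bullet> w j) * (v \<bullet> w j) * 1))"
  proof (rule sum_mono)
    fix j assume j: "j \<in> {..<?N}"
    show "(v \<bullet> w j) * (v \<bullet> w j) * (\<sigma> j)\<^sup>2 \<le> (\<sigma> k)\<^sup>2 * ((v \<bullet> w j) * (v \<bullet> w j) * 1)"
    proof (cases "j < k")
      case False
      then have "(\<sigma> j)\<^sup>2 \<le> (\<sigma> k)\<^sup>2"
        using j decr nonneg by (intro power_mono) auto
      then show ?thesis
        using mult_right_mono[of "(\<sigma> j)\<^sup>2" "(\<sigma> k)\<^sup>2" "(v \<bullet> w j) * (v \<bullet> w j)"]
        by (simp add: mult.commute)
    qed (simp add: orth)
  qed
  also have "\<dots> = (\<sigma> k)\<^sup>2 * (norm v)\<^sup>2"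
    unfolding power2_norm_eq_inner sum_distrib_left[symmetric] sq ..
  finally have "(norm (H *v v))\<^sup>2 \<le> (\<sigma> k * norm v)\<^sup>2"
    by (simp add: power_mult_distrib)
  then show ?thesis
    by (rule power2_le_imp_le) (simp add: nonneg k)
qed

text \<open>
  The heart of the lower bound. Let \<open>W\<close> be spanned by \<open>w 0, \<dots>, w k\<close> and let \<open>g\<close> send each of these
  to the left singular vector \<open>z i = H w i / \<sigma> i\<close>; \<open>g\<close> is isometric on \<open>W\<close>. By counting dimensions,
  \<open>W \<inter> T\<close> loses at most \<open>CARD('s2) - dim T\<close> of the \<open>k + 1\<close> dimensions of \<open>W\<close>, and requiring
  \<open>g x \<in> S\<close> costs at most \<open>CARD('s1) - dim S\<close> more. The total loss is at most \<open>k\<close>, so some nonzero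
  \<open>x \<in> W \<inter> T\<close> has \<open>g x \<in> S\<close>. For it \<open>g x \<bullet> H x\<close> is the sum of \<open>(x \<bullet> w i)\<^sup>2 \<sigma> i\<close> over \<open>i \<le> k\<close>,
  which is at least \<open>\<sigma> k\<close> times \<open>x \<bullet> x\<close>.
\<close>

lemma right_singular_system_lower_witness:
  fixes H :: "real^'s2^'s1"
  assumes sys: "right_singular_system H w \<sigma>" and k: "k < CARD('s2)" and pos: "\<sigma> k > 0"
    and S: "subspace S" and T: "subspace T"
    and dims: "dim S + dim T + k = CARD('s1) + CARD('s2)"
  obtains u v where "u \<in> S" "v \<in> T" "norm u = 1" "norm v = 1" "\<sigma> k \<le> u \<bullet> (H *v v)"
proof -
  let ?m = "Suc k"
  have ww: "\<And>i j. i < ?m \<Longrightarrow> j < ?m \<Longrightarrow> w i \<bullet> w j = (if i = j then 1 else 0)"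
    and HH: "\<And>i j. i < ?m \<Longrightarrow> j < ?m \<Longrightarrow> (H *v w i) \<bullet> (H *v w j) = (if i = j then (\<sigma> i)\<^sup>2 else 0)"
    and decr: "\<And>i. i < ?m \<Longrightarrow> \<sigma> k \<le> \<sigma> i"
    using sys k unfolding right_singular_system_def by auto
  have pos': "\<And>i. i < ?m \<Longrightarrow> \<sigma> i > 0"
    using decr pos by force
  define z where "z = (\<lambda>i. (H *v w i) /\<^sub>R \<sigma> i)"
  define g where "g = (\<lambda>x. \<Sum>i<?m. (x \<bullet> w i) *\<^sub>R z i)"
  let ?W = "span (w ` {..<?m})"
  have zz: "z i \<bullet> z j = (if i = j then 1 else 0)" if "i < ?m" "j < ?m" for i j
    using HH[OF that] pos'[OF that(1)] by (auto simp: z_def power2_eq_square field_simps)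
  have zH: "z i \<bullet> (H *v w j) = (if i = j then \<sigma> i else 0)" if "i < ?m" "j < ?m" for i j
    using HH[OF that] pos'[OF that(1)] by (auto simp: z_def power2_eq_square)
  have lin: "linear g"
    unfolding g_def by (intro linear_compose_sum ballI linearI)
      (auto simp: inner_add_left scaleR_add_left)
  have exp: "x = (\<Sum>i<?m. (x \<bullet> w i) *\<^sub>R w i)" if "x \<in> ?W" for x
    using orthonormal_family_span(2)[OF ww that] by simp
  have sq: "x \<bullet> x = (\<Sum>i<?m. (x \<bullet> w i) * (x \<bullet> w i) * 1)" if "x \<in> ?W" for x
    by (subst (1 2) exp[OF that]) (simp add: inner_sums_biorthogonal[OF ww] del: sum.lessThan_Suc)
  have "g x \<bullet> g x = x \<bullet> x" if "x \<in> ?W" for x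
    unfolding sq[OF that] g_def by (simp add: inner_sums_biorthogonal[OF zz] del: sum.lessThan_Suc)
  then have iso: "norm (g x) = norm x" if "x \<in> ?W" for x
    using that by (simp add: norm_eq_sqrt_inner)
  have "inj_on g ?W"
    by (subst linear_inj_on_iff_eq_0[OF lin]) (auto, metis iso norm_eq_zero)
  let ?X = "?W \<inter> T"
  have subX: "subspace ?X"
    by (simp add: T subspace_inter)
  have "inj_on g (span ?X)"
    using \<open>inj_on g ?W\<close> subX by (metis inf_le1 inj_on_subset span_eq_iff)
  then have dimg: "dim (g ` ?X) = dim ?X"
    by (intro dim_image_eq[OF lin])
  have "dim {x + y |x y. x \<in> ?W \<and> y \<in> T} + dim ?X = ?m + dim T"
    using dim_sums_Int[OF subspace_span T] orthonormal_family_span(1)[OF ww] by simp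
  moreover have "dim {x + y |x y. x \<in> ?W \<and> y \<in> T} \<le> CARD('s2)"
    using dim_subset_UNIV[where 'a="real^'s2"] by simp
  ultimately have "dim (g ` ?X) + dim S > DIM(real^'s1)"
    using dims dimg by simp
  then obtain y where y: "y \<in> g ` ?X" "y \<in> S" "y \<noteq> 0"
    using nonzero_vector_in_Int_of_dim[OF linear_subspace_image[OF lin subX] S] by blast
  then obtain x where x: "x \<in> ?W" "x \<in> T" "g x \<in> S" "g x \<noteq> 0"
    by blast
  define c where "c = norm x"
  have c: "c > 0"
    using x iso[OF x(1)] by (auto simp: c_def)
  have "H *v x = (\<Sum>i<?m. (x \<bullet> w i) *\<^sub>R (H *v w i))"
    by (subst exp[OF x(1)])
      (simp add: linear_sum[OF matrix_vector_mul_linear] matrix_vector_mult_scaleR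
        del: sum.lessThan_Suc)
  then have "g x \<bullet> (H *v x) = (\<Sum>i<?m. (x \<bullet> w i) * (x \<bullet> w i) * \<sigma> i)"
    unfolding g_def by (simp add: inner_sums_biorthogonal[OF zH] del: sum.lessThan_Suc)
  also have "\<dots> \<ge> (\<Sum>i<?m. (x \<bullet> w i) * (x \<bullet> w i) * \<sigma> k)"
    by (intro sum_mono mult_left_mono decr) auto
  also have "(\<Sum>i<?m. (x \<bullet> w i) * (x \<bullet> w i) * \<sigma> k) = \<sigma> k * c\<^sup>2"
    unfolding c_def power2_norm_eq_inner sq[OF x(1)] sum_distrib_left
    by (intro sum.cong) auto
  finally have "\<sigma> k * c\<^sup>2 \<le> g x \<bullet> (H *v x)" .
  then have "\<sigma> k \<le> (g x /\<^sub>R c) \<bullet> (H *v (x /\<^sub>R c))"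
    using c by (simp add: matrix_vector_mult_scaleR power2_eq_square field_simps)
  moreover have "norm (g x /\<^sub>R c) = 1" "norm (x /\<^sub>R c) = 1"
    using c by (simp_all add: iso[OF x(1)]) (simp_all add: c_def)
  moreover have "g x /\<^sub>R c \<in> S" "x /\<^sub>R c \<in> T"
    using S T x by (simp_all add: subspace_scale)
  ultimately show thesis using that by blast
qed

section \<open>The min-max principle in coordinates\<close>

lemma unit_values_has_maximum:
  fixes A :: "real^'n^'m"
  assumes S: "subspace S" "dim S > 0" and T: "subspace T" "dim T > 0"
  shows "\<exists>\<mu>. is_maximum (unit_values A S T) \<mu>"
proof -
  let ?K = "(S \<inter> sphere 0 1) \<times> (T \<inter> sphere 0 1)"
  have K: "compact ?K"
    using S T by (intro compact_Times closed_Int_compact closed_subspace) auto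
  obtain u v where "u \<in> S" "norm u = 1" "v \<in> T" "norm v = 1"
    using unit_vector_in_subspace S T by metis
  then have "?K \<noteq> {}" by auto
  moreover have "continuous_on ?K (\<lambda>p. fst p \<bullet> (A *v snd p))"
    by (intro continuous_intros bounded_linear.continuous_on[OF matrix_vector_mul_bounded_linear])
  ultimately obtain p where "p \<in> ?K" "\<And>q. q \<in> ?K \<Longrightarrow> fst q \<bullet> (A *v snd q) \<le> fst p \<bullet> (A *v snd p)"
    using continuous_attains_sup[OF K] by blast
  then have "is_maximum (unit_values A S T) (fst p \<bullet> (A *v snd p))"
    unfolding is_maximum_def unit_values_def by fastforce
  then show ?thesis ..
qed

text \<open>
  Replacing \<open>u\<close> by \<open>- u\<close> changes the sign of the value. This settles the lower bound for vanishing
  singular values, for which there is no left singular vector of the form \<open>H w / \<sigma>\<close>.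
\<close>

lemma maximum_unit_values_nonneg:
  assumes S: "subspace S" and "is_maximum (unit_values A S T) \<mu>"
  shows "0 \<le> \<mu>"
proof -
  obtain u v where uv: "u \<in> S" "v \<in> T" "norm u = 1" "norm v = 1" "\<mu> = u \<bullet> (A *v v)"
    using assms(2) by (auto simp: is_maximum_def unit_values_def)
  have "(- u) \<bullet> (A *v v) \<in> unit_values A S T"
    unfolding unit_values_def using uv S by (blast intro: subspace_neg norm_minus_cancel[THEN trans])
  then have "(- u) \<bullet> (A *v v) \<le> \<mu>"
    using assms(2) by (auto simp: is_maximum_def)
  then show ?thesis by (simp add: uv)
qed

text \<open>
  Every maximum is bounded below by \<open>\<sigma> k\<close>, through the dimension count if \<open>\<sigma> k > 0\<close> and through the
  sign symmetry otherwise; the bound is attained by the whole left space together with the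
  orthogonal complement of \<open>w 0, \<dots>, w (k - 1)\<close> on the right.
\<close>

lemma singular_system_minmax:
  fixes H :: "real^'s2^'s1"
  assumes sys: "right_singular_system H w \<sigma>" and k: "k < CARD('s1)" "k < CARD('s2)"
  defines "pairs \<equiv> subspace_pairs UNIV UNIV (CARD('s1) + CARD('s2) - k)"
  shows "\<forall>(S, T)\<in>pairs. \<exists>\<mu>. is_maximum (unit_values H S T) \<mu>"
    and "is_minimum {\<mu>. \<exists>(S, T)\<in>pairs. is_maximum (unit_values H S T) \<mu>} (\<sigma> k)"
proof -
  have pairsD: "subspace S" "subspace T" "dim S + dim T + k = CARD('s1) + CARD('s2)"
      "dim S > 0" "dim T > 0"
    if "(S, T) \<in> pairs" for S T
  proof -
    show ST: "subspace S" "subspace T" "dim S + dim T + k = CARD('s1) + CARD('s2)"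
      using that k by (auto simp: pairs_def subspace_pairs_def)
    (* The codimensions add up to k, which is smaller than either ambient dimension. *)
    have "dim S \<le> CARD('s1)" "dim T \<le> CARD('s2)"
      using dim_subset_UNIV[of S] dim_subset_UNIV[of T] by simp_all
    then show "dim S > 0" "dim T > 0"
      using ST(3) k by linarith+
  qed
  show ex: "\<forall>(S, T)\<in>pairs. \<exists>\<mu>. is_maximum (unit_values H S T) \<mu>"
    using pairsD unit_values_has_maximum by blast
  have lower: "\<sigma> k \<le> \<mu>" if ST: "(S, T) \<in> pairs" and mx: "is_maximum (unit_values H S T) \<mu>" for S T \<mu>
  proof (cases "\<sigma> k > 0")
    case True
    obtain u v where "u \<in> S" "v \<in> T" "norm u = 1" "norm v = 1" "\<sigma> k \<le> u \<bullet> (H *v v)"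
      using right_singular_system_lower_witness[OF sys k(2) True] pairsD[OF ST] by metis
    moreover from this have "u \<bullet> (H *v v) \<le> \<mu>"
      using mx by (auto simp: is_maximum_def unit_values_def)
    ultimately show ?thesis by linarith
  next
    case False
    then show ?thesis
      using maximum_unit_values_nonneg[OF pairsD(1)[OF ST] mx] by linarith
  qed
  have ww: "\<And>i j. i < k \<Longrightarrow> j < k \<Longrightarrow> w i \<bullet> w j = (if i = j then 1 else 0)"
    using sys k unfolding right_singular_system_def by auto
  define T where "T = {y \<in> UNIV. \<forall>x\<in>span (w ` {..<k}). orthogonal x y}"
  have "dim T + k = CARD('s2)"
    using dim_subspace_orthogonal_to_vectors[OF subspace_span[of "w ` {..<k}"] subspace_UNIV]
      orthonormal_family_span(1)[OF ww] unfolding T_def by simp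
  moreover have "subspace T"
    by (auto simp: T_def subspace_def orthogonal_clauses)
  ultimately have UT: "(UNIV, T) \<in> pairs"
    using k by (auto simp: pairs_def subspace_pairs_def)
  then obtain \<mu> where \<mu>: "is_maximum (unit_values H UNIV T) \<mu>"
    using ex by blast
  then obtain u v where uv: "v \<in> T" "norm u = 1" "norm v = 1" "\<mu> = u \<bullet> (H *v v)"
    by (auto simp: is_maximum_def unit_values_def)
  have vw: "v \<bullet> w j = 0" if "j < k" for j
    using uv(1) that by (auto simp: T_def orthogonal_def inner_commute span_base)
  have "\<mu> \<le> norm (H *v v)"
    using norm_cauchy_schwarz[of u "H *v v"] uv by simp
  also have "\<dots> \<le> \<sigma> k"
    using right_singular_system_norm_le[OF sys k(2) vw] uv(3) by simp
  finally have "\<mu> = \<sigma> k"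
    using lower[OF UT \<mu>] by simp
  then show "is_minimum {\<mu>. \<exists>(S, T)\<in>pairs. is_maximum (unit_values H S T) \<mu>} (\<sigma> k)"
    unfolding is_minimum_def using UT \<mu> lower by blast
qed

section \<open>Transport to the search subspaces\<close>

lemma orthonormal_columns_inner:
  assumes "orthonormal_columns U"
  shows "(U *v x) \<bullet> (U *v y) = x \<bullet> y"
proof -
  have "transpose U ** U = mat 1"
    using assms by (simp add: orthonormal_columns_def matrix_mult_transpose_dot_column mat_def)
  then show ?thesis
    by (metis dot_lmul_matrix matrix_vector_mul_assoc matrix_vector_mul_lid transpose_matrix_vector)
qed

lemma orthonormal_columns_norm:
  "orthonormal_columns U \<Longrightarrow> norm (U *v x) = norm x"
  by (simp add: norm_eq_sqrt_inner orthonormal_columns_inner)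

lemma orthonormal_columns_inj:
  fixes U :: "real^'s^'m"
  assumes "orthonormal_columns U"
  shows "inj ((*v) U)"
  using orthonormal_columns_norm[OF assms]
  by (subst linear_inj_iff_eq_0[OF matrix_vector_mul_linear]) (metis norm_eq_zero)

lemma span_columns_eq_range:
  fixes U :: "real^'s^'m"
  shows "span (columns U) = range ((*v) U)"
proof -
  have "range (\<lambda>i. axis i 1) = (Basis :: (real^'s) set)"
    by (auto simp: Basis_vec_def)
  then show ?thesis
    by (simp add: columns_image_basis linear_span_image[OF matrix_vector_mul_linear])
qed

text \<open>
  \<open>U\<close> is injective with range the span of its columns, so taking images is a dimension-preserving
  bijection from the subspaces of the coordinate space to those of the search subspace.
\<close>

lemma subspace_of_span_columns:
  fixes U :: "real^'s^'m"
  assumes U: "orthonormal_columns U"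
  shows "subspace S \<and> S \<subseteq> span (columns U) \<and> dim S = d \<longleftrightarrow>
    (\<exists>S'. S = (*v) U ` S' \<and> subspace S' \<and> dim S' = d)"
proof
  assume S: "subspace S \<and> S \<subseteq> span (columns U) \<and> dim S = d"
  let ?S' = "(*v) U -` S"
  have "S = (*v) U ` ?S'"
    using S by (auto simp: span_columns_eq_range)
  moreover have "subspace ?S'"
    using S by (simp add: linear_subspace_vimage)
  ultimately show "\<exists>S'. S = (*v) U ` S' \<and> subspace S' \<and> dim S' = d"
    using S dim_image_eq[OF matrix_vector_mul_linear inj_on_subset[OF orthonormal_columns_inj[OF U]], of ?S']
    by (metis subset_UNIV)
next
  assume "\<exists>S'. S = (*v) U ` S' \<and> subspace S' \<and> dim S' = d"
  then show "subspace S \<and> S \<subseteq> span (columns U) \<and> dim S = d"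
    using dim_image_eq[OF matrix_vector_mul_linear inj_on_subset[OF orthonormal_columns_inj[OF U]]]
    by (auto simp: span_columns_eq_range linear_subspace_image)
qed

lemma subspace_pairs_span_columns:
  fixes U :: "real^'s1^'m" and V :: "real^'s2^'n"
  assumes "orthonormal_columns U" "orthonormal_columns V"
  shows "subspace_pairs (span (columns U)) (span (columns V)) d =
    (\<lambda>(S, T). ((*v) U ` S, (*v) V ` T)) ` subspace_pairs UNIV UNIV d"
proof -
  note U = subspace_of_span_columns[OF assms(1)] and V = subspace_of_span_columns[OF assms(2)]
  show ?thesis
  proof (intro set_eqI iffI; clarify)
    fix S T assume "(S, T) \<in> subspace_pairs (span (columns U)) (span (columns V)) d"
    then obtain S' T' where "S = (*v) U ` S'" "T = (*v) V ` T'" "subspace S'" "subspace T'"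
        "dim S' + dim T' = d"
      using U[of S "dim S"] V[of T "dim T"] by (auto simp: subspace_pairs_def)
    then show "(S, T) \<in> (\<lambda>(S, T). ((*v) U ` S, (*v) V ` T)) ` subspace_pairs UNIV UNIV d"
      by (auto simp: subspace_pairs_def)
  next
    fix S T assume "(S, T) \<in> subspace_pairs (UNIV :: (real^'s1) set) (UNIV :: (real^'s2) set) d"
    then show "((*v) U ` S, (*v) V ` T) \<in> subspace_pairs (span (columns U)) (span (columns V)) d"
      using U[of "(*v) U ` S" "dim S"] V[of "(*v) V ` T" "dim T"]
      by (auto simp: subspace_pairs_def)
  qed
qed

lemma unit_values_image:
  assumes "orthonormal_columns U" "orthonormal_columns V"
  shows "unit_values A ((*v) U ` S) ((*v) V ` T) = unit_values (transpose U ** A ** V) S T"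
proof -
  have "(U *v x) \<bullet> (A *v (V *v y)) = x \<bullet> ((transpose U ** A ** V) *v y)" for x y
    by (metis dot_lmul_matrix matrix_vector_mul_assoc transpose_matrix_vector transpose_transpose)
  moreover have "c \<in> unit_values A ((*v) U ` S) ((*v) V ` T) \<longleftrightarrow>
      (\<exists>x\<in>S. \<exists>y\<in>T. c = (U *v x) \<bullet> (A *v (V *v y)) \<and> norm (U *v x) = 1 \<and> norm (V *v y) = 1)" for c
    unfolding unit_values_def by blast
  ultimately show ?thesis
    by (auto simp: unit_values_def orthonormal_columns_norm[OF assms(1)]
        orthonormal_columns_norm[OF assms(2)])
qed

theorem theorem2p5:
  fixes A :: "real^'n^'m" and U :: "real^'s1^'m" and V :: "real^'s2^'n"
    and \<theta> :: "real list"
  assumes "orthonormal_columns U" and "orthonormal_columns V"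
    and "\<theta> = ritz_singular_values A U V"
  shows "length \<theta> = min CARD('s1) CARD('s2) \<and> sorted_wrt (\<ge>) \<theta> \<and> (\<forall>t\<in>set \<theta>. 0 \<le> t) \<and>
    (\<forall>i\<in>{1..min CARD('s1) CARD('s2)}.
      let pairs = subspace_pairs (span (columns U)) (span (columns V))
                    (CARD('s1) + CARD('s2) - i + 1)
      in (\<forall>(Su, Sv)\<in>pairs. \<exists>\<mu>. is_maximum (unit_values A Su Sv) \<mu>) \<and>
         is_minimum {\<mu>. \<exists>(Su, Sv)\<in>pairs. is_maximum (unit_values A Su Sv) \<mu>} (\<theta> ! (i - 1)))"
proof -
  let ?H = "transpose U ** A ** V" and ?n = "min CARD('s1) CARD('s2)"
  obtain w \<sigma> where sys: "right_singular_system ?H w \<sigma>"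
    and sv: "singular_values ?H = map \<sigma> [0..<?n]"
    by (rule right_singular_system_exists)
  have \<theta>: "\<theta> = map \<sigma> [0..<?n]"
    using assms(3) sv by (simp add: ritz_singular_values_def)
  have "sorted_wrt (\<ge>) \<theta>" "\<forall>t\<in>set \<theta>. 0 \<le> t"
    using sys unfolding \<theta> right_singular_system_def
    by (auto simp: sorted_wrt_iff_nth_less)
  moreover have
    "let pairs = subspace_pairs (span (columns U)) (span (columns V))
                   (CARD('s1) + CARD('s2) - i + 1)
     in (\<forall>(Su, Sv)\<in>pairs. \<exists>\<mu>. is_maximum (unit_values A Su Sv) \<mu>) \<and>
        is_minimum {\<mu>. \<exists>(Su, Sv)\<in>pairs. is_maximum (unit_values A Su Sv) \<mu>} (\<theta> ! (i - 1))"
    if i: "i \<in> {1..?n}" for i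
  proof -
    have k: "i - 1 < CARD('s1)" "i - 1 < CARD('s2)"
      using i by auto
    have "CARD('s1) + CARD('s2) - i + 1 = CARD('s1) + CARD('s2) - (i - 1)"
      using i by auto
    moreover have "\<theta> ! (i - 1) = \<sigma> (i - 1)"
      using k by (simp add: \<theta>)
    ultimately show ?thesis
      using singular_system_minmax[OF sys k]
      by (simp add: subspace_pairs_span_columns[OF assms(1,2)] unit_values_image[OF assms(1,2)]
          case_prod_unfold)
  qed
  ultimately show ?thesis
    by (simp add: \<theta>)
qed

end
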